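(* Let $\mathfrak{G}$ be an alphabet and let $\mathcal{P}$ and $\mathcal{Q}$ be two subsets of $\mathbf{S}(\mathfrak{G})\setminus\{\perp\}$ such that for every letter $\mathtt{a}\in\mathfrak{G}$ there are finitely many minimal $(\mathcal{P}\cup\mathcal{Q})_\mathtt{a}$-consistent words. Then the $\mathfrak{G}$-tree series $\mathbf{F}(\mathcal{P},\mathcal{Q})$ satisfies \[ \mathbf{F}(\mathcal{P},\mathcal{Q})=\perp+\sum_{\substack{k\ge1\\ \mathtt{a}\in\mathfrak{G}(k)}}\ \sum_{\substack{\ell\ge1\\ \{\mathcal{R}^{(1)},\dots,\mathcal{R}^{(\ell)}\}\subseteq\mathfrak{M}((\mathcal{P}\cup\mathcal{Q})_\mathtt{a})\\ (\mathcal{S}_1,\dots,\mathcal{S}_k)=\mathcal{R}^{(1)}\oplus\cdots\oplus\mathcal{R}^{(\ell)}}}(-1)^{1+\ell}\ \mathtt{a}\odot\big[\mathbf{F}(\mathcal{P},\mathcal{S}_1),\dots,\mathbf{F}(\mathcal{P},\mathcal{S}_k)\big], \] where the inner sum runs over the nonempty sets of $\ell$ distinct minimal consistent words.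
   Context: An alphabet is a graded set $\mathfrak{G}=\bigsqcup_{n\ge1}\mathfrak{G}(n)$; a letter $x\in\mathfrak{G}(n)$ has arity $n$. A $\mathfrak{G}$-tree is a planar rooted tree whose internal nodes of arity $k$ are labeled by letters of $\mathfrak{G}(k)$; $\mathbf{S}(\mathfrak{G})$ is the set of all $\mathfrak{G}$-trees. Its arity $|\mathfrak{t}|$ is its number of leaves, its degree its number of internal nodes. $\perp$ denotes the tree consisting of a single leaf (degree 0). For a letter $\mathtt{a}$ of arity $k$, the corolla $\mathtt{a}$ is the tree with one internal node labeled $\mathtt{a}$ and $k$ leaves. If the root of $\mathfrak{t}$ has arity $k$, $\mathfrak{t}(i)$ ($i\in[k]$) is the subtree rooted at the $i$th child of the root. $\mathfrak{t}\circ_i\mathfrak{s}$ grafts the root of $\mathfrak{s}$ onto the $i$th leaf of $\mathfrak{t}$; $\mathfrak{t}\circ[\mathfrak{s}_1,\dots,\mathfrak{s}_{|\mathfrak{t}|}]$ grafts simultaneously each $\mathfrak{s}_i$ onto the $i$th leaf of $\mathfrak{t}$. A tree $\mathfrak{s}$ is a factor of $\mathfrak{t}$ if $\mathfrak{t}=\mathfrak{r}\circ_i(\mathfrak{s}\circ[\mathfrak{r}_1,\dots,\mathfrak{r}_{|\mathfrak{s}|}])$ for some $\mathfrak{G}$-trees $\mathfrak{r},\mathfrak{r}_1,\dots$ and $i\in[|\mathfrak{r}|]$; it is a prefix if moreover one can take $\mathfrak{r}=\perp$. $\mathfrak{t}$ factor-avoids (resp. prefix-avoids) a set $\mathcal{P}$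 if no element of $\mathcal{P}$ is a factor (resp. prefix) of $\mathfrak{t}$. $\mathbb{K}$ is a field of characteristic zero; a $\mathfrak{G}$-tree series is a map $\mathbf{f}:\mathbf{S}(\mathfrak{G})\to\mathbb{K}$, written $\sum_{\mathfrak{t}}\langle\mathfrak{t},\mathbf{f}\rangle\mathfrak{t}$. For series $\mathbf{f},\mathbf{g}_1,\dots,\mathbf{g}_n$, $\mathbf{f}\odot[\mathbf{g}_1,\dots,\mathbf{g}_n]:=\sum_{\mathfrak{t}\text{ of arity }n,\ \mathfrak{s}_1,\dots,\mathfrak{s}_n}\langle\mathfrak{t},\mathbf{f}\rangle\prod_i\langle\mathfrak{s}_i,\mathbf{g}_i\rangle\,\mathfrak{t}\circ[\mathfrak{s}_1,\dots,\mathfrak{s}_n]$; for a letter $\mathtt{a}$, $\mathtt{a}\odot[\dots]$ means the corolla $\mathtt{a}$ composed this way. For $\mathcal{P},\mathcal{Q}\subseteq\mathbf{S}(\mathfrak{G})\setminus\{\perp\}$, $\mathbf{F}(\mathcal{P},\mathcal{Q})$ is the sum of all $\mathfrak{G}$-trees that factor-avoid $\mathcal{P}$ and prefix-avoid $\mathcal{Q}$. For $\mathcal{P}\subseteq\mathbf{S}(\mathfrak{G})\setminus\{\perp\}$ and $\mathtt{a}\in\mathfrak{G}(k)$, $\mathcal{P}_\mathtt{a}$ is the set of trees of $\mathcal{P}$ whose root is labeled $\mathtt{a}$. A word $(\mathcal{S}_1,\dots,\mathcal{S}_k)$ of subsets of $\mathbf{S}(\mathfrak{G})$ is $\mathcal{P}_\mathtt{a}$-consistent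 if for every $\mathfrak{s}\in\mathcal{P}_\mathtt{a}$ there is $i\in[k]$ with $\mathfrak{s}(i)\ne\perp$ and $\mathfrak{s}(i)\in\mathcal{S}_i$. The sum of two words of the same length is $(\mathcal{S}_1,\dots,\mathcal{S}_k)\oplus(\mathcal{S}'_1,\dots,\mathcal{S}'_k):=(\mathcal{S}_1\cup\mathcal{S}'_1,\dots,\mathcal{S}_k\cup\mathcal{S}'_k)$. A $\mathcal{P}_\mathtt{a}$-consistent word $\mathcal{S}$ is minimal if whenever $\mathcal{S}=\mathcal{S}'\oplus\mathcal{S}''$ with $\mathcal{S}'$ $\mathcal{P}_\mathtt{a}$-consistent and $\mathcal{S}''$ any word of subsets of $\mathbf{S}(\mathfrak{G})$ of length $k$, then $\mathcal{S}=\mathcal{S}'$. $\mathfrak{M}(\mathcal{P}_\mathtt{a})$ denotes the set of minimal $\mathcal{P}_\mathtt{a}$-consistent words. *)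

theory Defs
  imports Complex_Main "HOL-Library.Disjoint_Sets"
begin

text \<open>
  An alphabet is a family \<open>G\<close> of pairwise disjoint sets, \<open>G n\<close> being the letters of arity \<open>n\<close>;
  there are no letters of arity \<open>0\<close>.
\<close>

definition alphabet :: "(nat \<Rightarrow> 'a set) \<Rightarrow> bool" where
  "alphabet G \<longleftrightarrow> disjoint_family G \<and> G 0 = {}"

text \<open>
  The datatype only provides labelled planar terms; the trees over the alphabet \<open>G\<close> are the
  terms in \<open>gtrees G\<close>. Children and leaves are numbered from \<open>0\<close>.
\<close>

datatype 'a gtree = Leaf | Node 'a (children: "'a gtree list")
  where "children Leaf = []"

inductive_set gtrees :: "(nat \<Rightarrow> 'a set) \<Rightarrow> 'a gtree set" for G :: "nat \<Rightarrow> 'a set" where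
  Leaf: "Leaf \<in> gtrees G"
| Node: "a \<in> G (length ts) \<Longrightarrow> \<forall>t\<in>set ts. t \<in> gtrees G \<Longrightarrow> Node a ts \<in> gtrees G"

fun arity :: "'a gtree \<Rightarrow> nat" where
  "arity Leaf = 1"
| "arity (Node a ts) = sum_list (map arity ts)"

definition corolla :: "nat \<Rightarrow> 'a \<Rightarrow> 'a gtree" where
  "corolla k a = Node a (replicate k Leaf)"

text \<open>
  \<open>graft t ss\<close> replaces the leaves of \<open>t\<close>, from left to right, by the elements of \<open>ss\<close>;
  it is meaningful when \<open>length ss = arity t\<close>.
\<close>

fun graft :: "'a gtree \<Rightarrow> 'a gtree list \<Rightarrow> 'a gtree"
  and graft_list :: "'a gtree list \<Rightarrow> 'a gtree list \<Rightarrow> 'a gtree list" where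
  "graft Leaf ss = hd ss"
| "graft (Node a ts) ss = Node a (graft_list ts ss)"
| "graft_list [] ss = []"
| "graft_list (t # ts) ss = graft t (take (arity t) ss) # graft_list ts (drop (arity t) ss)"

definition graft_at :: "'a gtree \<Rightarrow> nat \<Rightarrow> 'a gtree \<Rightarrow> 'a gtree" where
  "graft_at t i s = graft t ((replicate (arity t) Leaf)[i := s])"

lemma graft_at_Leaf [simp]: "graft_at Leaf 0 s = s"
  by (simp add: graft_at_def)

lemma length_graft_list [simp]: "length (graft_list ts ss) = length ts"
  by (induction ts arbitrary: ss) auto

lemma graft_list_replicate_Leaf:
  "length ss = k \<Longrightarrow> graft_list (replicate k Leaf) ss = ss"
proof (induction k arbitrary: ss)
  case (Suc k)
  then show ?case by (cases ss) auto
qed simp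

lemma graft_corolla: "length ss = k \<Longrightarrow> graft (corolla k a) ss = Node a ss"
  by (simp add: corolla_def graft_list_replicate_Leaf)

definition is_factor :: "(nat \<Rightarrow> 'a set) \<Rightarrow> 'a gtree \<Rightarrow> 'a gtree \<Rightarrow> bool" where
  "is_factor G s t \<longleftrightarrow>
     (\<exists>r\<in>gtrees G. \<exists>i<arity r. \<exists>rs\<in>lists (gtrees G).
        length rs = arity s \<and> t = graft_at r i (graft s rs))"

definition is_prefix :: "(nat \<Rightarrow> 'a set) \<Rightarrow> 'a gtree \<Rightarrow> 'a gtree \<Rightarrow> bool" where
  "is_prefix G s t \<longleftrightarrow>
     (\<exists>rs\<in>lists (gtrees G). length rs = arity s \<and> t = graft_at Leaf 0 (graft s rs))"

definition factor_avoids :: "(nat \<Rightarrow> 'a set) \<Rightarrow> 'a gtree \<Rightarrow> 'a gtree set \<Rightarrow> bool" where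
  "factor_avoids G t P \<longleftrightarrow> (\<forall>s\<in>P. \<not> is_factor G s t)"

definition prefix_avoids :: "(nat \<Rightarrow> 'a set) \<Rightarrow> 'a gtree \<Rightarrow> 'a gtree set \<Rightarrow> bool" where
  "prefix_avoids G t P \<longleftrightarrow> (\<forall>s\<in>P. \<not> is_prefix G s t)"

text \<open>
  A tree series over \<open>G\<close> is a coefficient function on \<open>gtrees G\<close>. It is represented by a
  function on the whole datatype, with all series constructed below vanishing outside of
  \<open>gtrees G\<close>, so that equality of functions is equality of series.
\<close>

type_synonym ('a, 'k) tree_series = "'a gtree \<Rightarrow> 'k"

definition single :: "'a gtree \<Rightarrow> ('a, 'k::field_char_0) tree_series" where
  "single t = (\<lambda>u. if u = t then 1 else 0)"

definition avoiding_series ::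
    "(nat \<Rightarrow> 'a set) \<Rightarrow> 'a gtree set \<Rightarrow> 'a gtree set \<Rightarrow> ('a, 'k::field_char_0) tree_series" where
  "avoiding_series G P Q =
     (\<lambda>t. if t \<in> gtrees G \<and> factor_avoids G t P \<and> prefix_avoids G t Q then 1 else 0)"

text \<open>
  The coefficient of \<open>u\<close> in a composition only involves the finitely many ways of writing \<open>u\<close>
  as \<open>graft t ss\<close>, see \<open>finite_graft_decompositions\<close> below.
\<close>

definition series_comp ::
    "(nat \<Rightarrow> 'a set) \<Rightarrow> ('a, 'k::field_char_0) tree_series \<Rightarrow> ('a, 'k) tree_series list \<Rightarrow>
     ('a, 'k) tree_series" where
  "series_comp G f gs = (\<lambda>u.
     \<Sum>(t, ss) | t \<in> gtrees G \<and> arity t = length gs \<and>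
                 ss \<in> lists (gtrees G) \<and> length ss = length gs \<and> graft t ss = u.
       f t * (\<Prod>i<length gs. (gs ! i) (ss ! i)))"

lemma finite_graft_decompositions:
  "finite {(t, ss). length ss = arity t \<and> graft t ss = u}"
proof -
  have "finite {(t, ss). length ss = arity t \<and> graft t ss = u} \<and>
        (\<forall>us \<in> {children u}. finite {(ts, ss). length ss = sum_list (map arity ts) \<and> graft_list ts ss = us})"
    for u :: "'a gtree"
  proof (induction u)
    case Leaf
    have "{(t, ss). length ss = arity t \<and> graft t ss = Leaf} \<subseteq> {(Leaf, [Leaf :: 'a gtree])}"
    proof clarify
      fix t and ss :: "'a gtree list"
      assume "length ss = arity t" "graft t ss = Leaf"
      then show "t = Leaf \<and> ss = [Leaf]"
        by (cases t; cases ss) auto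
    qed
    moreover have "{(ts, ss). length ss = sum_list (map arity ts) \<and> graft_list ts ss = []}
                   \<subseteq> {([], [] :: 'a gtree list)}"
    proof clarify
      fix ts ss :: "'a gtree list"
      assume "length ss = sum_list (map arity ts)" "graft_list ts ss = []"
      then show "ts = [] \<and> ss = []" by (cases ts) auto
    qed
    ultimately show ?case
      by (auto intro: finite_subset)
  next
    case (Node a us)
    have L: "finite {(ts, ss). length ss = sum_list (map arity ts) \<and> graft_list ts ss = vs}"
      if "set vs \<subseteq> set us" for vs
      using that
    proof (induction vs)
      case Nil
      have "{(ts, ss). length ss = sum_list (map arity ts) \<and> graft_list ts ss = []}
                     \<subseteq> {([], [] :: 'a gtree list)}"
      proof clarify
        fix ts ss :: "'a gtree list"
        assume "length ss = sum_list (map arity ts)" "graft_list ts ss = []"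
        then show "ts = [] \<and> ss = []" by (cases ts) auto
      qed
      then show ?case by (rule finite_subset) simp
    next
      case (Cons v vs)
      let ?A = "{(t, ss). length ss = arity t \<and> graft t ss = v}"
      let ?B = "{(ts, ss). length ss = sum_list (map arity ts) \<and> graft_list ts ss = vs}"
      let ?h = "\<lambda>((t, ss), (ts, ss')). (t # ts, ss @ ss')"
      have "finite ?A" "finite ?B" using Node Cons by auto
      moreover have "{(ts, ss). length ss = sum_list (map arity ts) \<and> graft_list ts ss = v # vs}
                     \<subseteq> ?h ` (?A \<times> ?B)"
      proof clarify
        fix ts ss :: "'a gtree list"
        assume *: "length ss = sum_list (map arity ts)" "graft_list ts ss = v # vs"
        then obtain t ts' where ts: "ts = t # ts'" by (cases ts) auto
        have "(t, take (arity t) ss) \<in> ?A" "(ts', drop (arity t) ss) \<in> ?B"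
          using * ts by auto
        then show "(ts, ss) \<in> ?h ` (?A \<times> ?B)"
          unfolding ts by (intro image_eqI[of _ _ "((t, take (arity t) ss), (ts', drop (arity t) ss))"]) auto
      qed
      ultimately show ?case
        by (meson finite_SigmaI finite_imageI finite_subset)
    qed
    let ?C = "{(ts, ss). length ss = sum_list (map arity ts) \<and> graft_list ts ss = us}"
    have "{(t, ss). length ss = arity t \<and> graft t ss = Node a us}
          \<subseteq> insert (Leaf, [Node a us]) ((\<lambda>(ts, ss). (Node a ts, ss)) ` ?C)"
    proof (rule subsetI, clarify)
      fix t and ss :: "'a gtree list"
      assume *: "length ss = arity t" "graft t ss = Node a us"
        and "(t, ss) \<notin> (\<lambda>(ts, ss). (Node a ts, ss)) ` ?C"
      then show "t = Leaf \<and> ss = [Node a us]"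
        by (cases t; cases ss) force+
    qed
    moreover have "finite ?C" using L[of us] by simp
    ultimately show ?case
      using finite_subset by (simp, blast)
  qed
  then show ?thesis by blast
qed

text \<open>
  The sum of a possibly infinite family of series, taken coefficientwise; it is meaningful when
  every tree has a nonzero coefficient in only finitely many members of the family.
\<close>

definition series_sum :: "('i \<Rightarrow> ('a, 'k::field_char_0) tree_series) \<Rightarrow> 'i set \<Rightarrow> ('a, 'k) tree_series" where
  "series_sum f A = (\<lambda>t. \<Sum>x | x \<in> A \<and> f x t \<noteq> 0. f x t)"

text \<open>
  Families of linear combinations of compositions with corollas, indexed by the letters,
  satisfy this finiteness condition, because of the following fact.
\<close>

lemma series_comp_corolla_nonzeroD:
  fixes gs :: "('a, 'k::field_char_0) tree_series list"
  assumes "series_comp G (single (corolla k a)) gs t \<noteq> 0"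
  shows "\<exists>ts. t = Node a ts \<and> length ts = k"
proof -
  obtain u ss where "graft u ss = t" "single (corolla k a) u \<noteq> (0::'k)"
    using assms unfolding series_comp_def by (auto elim!: sum.not_neutral_contains_not_neutral)
  then show ?thesis
    by (auto simp: single_def corolla_def split: if_splits)
qed

definition rooted_at :: "'a gtree set \<Rightarrow> 'a \<Rightarrow> 'a gtree set" where
  "rooted_at P a = {t \<in> P. \<exists>ts. t = Node a ts}"

definition tree_set_words :: "(nat \<Rightarrow> 'a set) \<Rightarrow> nat \<Rightarrow> 'a gtree set list set" where
  "tree_set_words G k = {W. length W = k \<and> (\<forall>S\<in>set W. S \<subseteq> gtrees G)}"

definition word_add :: "'a set list \<Rightarrow> 'a set list \<Rightarrow> 'a set list" (infixl "\<oplus>" 65) where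
  "V \<oplus> W = map2 (\<union>) V W"

definition consistent :: "(nat \<Rightarrow> 'a set) \<Rightarrow> nat \<Rightarrow> 'a gtree set \<Rightarrow> 'a gtree set list \<Rightarrow> bool" where
  "consistent G k P W \<longleftrightarrow>
     W \<in> tree_set_words G k \<and>
     (\<forall>s\<in>P. \<exists>i<k. children s ! i \<noteq> Leaf \<and> children s ! i \<in> W ! i)"

definition minimal_consistent ::
    "(nat \<Rightarrow> 'a set) \<Rightarrow> nat \<Rightarrow> 'a gtree set \<Rightarrow> 'a gtree set list \<Rightarrow> bool" where
  "minimal_consistent G k P W \<longleftrightarrow>
     consistent G k P W \<and>
     (\<forall>W' W''. consistent G k P W' \<and> W'' \<in> tree_set_words G k \<and> W = W' \<oplus> W'' \<longrightarrow> W = W')"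

definition minimal_words ::
    "(nat \<Rightarrow> 'a set) \<Rightarrow> nat \<Rightarrow> 'a gtree set \<Rightarrow> 'a gtree set list set" where
  "minimal_words G k P = {W. minimal_consistent G k P W}"

text \<open>
  The sum of all the words in a set of words of length \<open>k\<close>. The two lemmas identify it with
  the iterated binary sum.
\<close>

definition word_sum :: "nat \<Rightarrow> 'a set list set \<Rightarrow> 'a set list" where
  "word_sum k \<R> = map (\<lambda>i. \<Union>R\<in>\<R>. R ! i) [0..<k]"

lemma word_sum_singleton: "length R = k \<Longrightarrow> word_sum k {R} = R"
  by (simp add: word_sum_def list_eq_iff_nth_eq)

lemma word_sum_insert: "length R = k \<Longrightarrow> word_sum k (insert R \<R>) = R \<oplus> word_sum k \<R>"
  by (simp add: word_sum_def word_add_def list_eq_iff_nth_eq)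

end

(*
  The tree t with root a and children t_1, ..., t_k avoids P as factors and Q as prefixes iff its
  children factor-avoid P and t prefix-avoids X = (P \<union> Q)_a. The latter says that the word W(t),
  whose i-th entry consists of the trees that are not prefixes of t_i, is X-consistent. As every
  tree of X has only k children, Zorn's lemma yields a minimal word below each consistent word;
  hence t avoids X iff some minimal word lies below W(t). On the other hand, t is a term of
  a \<odot> [F(P, S_1), ..., F(P, S_k)] iff its children factor-avoid P and S lies below W(t), and
  a sum of words lies below W(t) iff each of them does. The formula is therefore inclusion-exclusion
  over the minimal words below W(t).
*)
theory Submission
  imports Defs
begin

section \<open>Prefixes and factors of a tree in terms of its children\<close>

lemma gtrees_Node_iff [simp]:
  "Node a ts \<in> gtrees G \<longleftrightarrow> a \<in> G (length ts) \<and> set ts \<subseteq> gtrees G"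
  by (subst gtrees.simps) auto

lemma graft_replicate_Leaf [simp]: "graft t (replicate (arity t) Leaf) = t"
proof (induction t)
  case (Node a ts)
  then have "graft_list ts (replicate (sum_list (map arity ts)) Leaf) = ts"
    by (induction ts) (auto simp: min_def)
  then show ?case by simp
qed simp

lemma graft_list_replicate_arity [simp]:
  "graft_list ts (replicate (sum_list (map arity ts)) Leaf) = ts"
  by (induction ts) (auto simp: min_def)

text \<open>The leaves of \<open>us\<close> are numbered in consecutive blocks, one per tree. Leaf
  \<open>i\<close> either falls in the first block or, after subtracting \<open>arity u\<close>, is
  a leaf of the tail.\<close>

lemma graft_list_update_obtain:
  assumes "i < sum_list (map arity us)"
  obtains j i' where "j < length us" "i' < arity (us ! j)"
    "graft_list us ((replicate (sum_list (map arity us)) Leaf)[i := x]) =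
       us[j := graft_at (us ! j) i' x]"
  using assms
proof (induction us arbitrary: i thesis)
  case (Cons u us)
  show ?case
  proof (cases "i < arity u")
    case True
    then show ?thesis
      by (intro Cons.prems(1)[of 0 i])
        (auto simp: graft_at_def replicate_add list_update_append)
  next
    case False
    then have "i - arity u < sum_list (map arity us)"
      using Cons.prems(2) by auto
    then obtain j i' where "j < length us" "i' < arity (us ! j)"
      "graft_list us ((replicate (sum_list (map arity us)) Leaf)[i - arity u := x]) =
         us[j := graft_at (us ! j) i' x]"
      using Cons.IH by metis
    with False show ?thesis
      by (intro Cons.prems(1)[of "Suc j" i'])
        (auto simp: replicate_add list_update_append)
  qed
qed simp

text \<open>Conversely, the global position is \<open>i'\<close> shifted by the arities of the trees
  before \<open>us ! j\<close>. This lets an occurrence inside a child be seen inside its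
  parent.\<close>

lemma graft_list_update_exists:
  assumes "j < length us" "i' < arity (us ! j)"
  shows "\<exists>i < sum_list (map arity us).
    graft_list us ((replicate (sum_list (map arity us)) Leaf)[i := x]) =
      us[j := graft_at (us ! j) i' x]"
  using assms
proof (induction us arbitrary: j)
  case (Cons u us)
  show ?case
  proof (cases j)
    case 0
    with Cons.prems show ?thesis
      by (intro exI[of _ i']) (auto simp: graft_at_def replicate_add list_update_append)
  next
    case (Suc m)
    with Cons obtain i where "i < sum_list (map arity us)"
      "graft_list us ((replicate (sum_list (map arity us)) Leaf)[i := x]) =
         us[m := graft_at (us ! m) i' x]"
      by (metis Suc_less_SucD length_Cons nth_Cons_Suc)
    with Suc show ?thesis
      by (intro exI[of _ "arity u + i"]) (auto simp: replicate_add list_update_append)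
  qed
qed simp

lemma is_prefix_iff_graft:
  "is_prefix G s t \<longleftrightarrow> (\<exists>rs\<in>lists (gtrees G). length rs = arity s \<and> t = graft s rs)"
  by (simp add: is_prefix_def)

lemma is_prefix_Leaf [simp]: "is_prefix G Leaf t \<longleftrightarrow> t \<in> gtrees G"
proof
  assume "t \<in> gtrees G"
  then show "is_prefix G Leaf t"
    unfolding is_prefix_iff_graft by (intro bexI[of _ "[t]"]) auto
qed (auto simp: is_prefix_iff_graft length_Suc_conv)

text \<open>The leaves of the forest \<open>ss\<close> are the concatenated leaves of its trees, so
  \<open>rs\<close> splits into independent blocks, and blocks chosen separately can be
  appended.\<close>

lemma graft_list_iff_prefixes:
  "(\<exists>rs\<in>lists (gtrees G). length rs = sum_list (map arity ss) \<and> ts = graft_list ss rs) \<longleftrightarrow>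
     list_all2 (is_prefix G) ss ts"
proof (induction ss arbitrary: ts)
  case (Cons s ss)
  show ?case
  proof
    assume "\<exists>rs\<in>lists (gtrees G).
      length rs = sum_list (map arity (s # ss)) \<and> ts = graft_list (s # ss) rs"
    then obtain rs where rs: "set rs \<subseteq> gtrees G" "length rs = arity s + sum_list (map arity ss)"
      "ts = graft s (take (arity s) rs) # graft_list ss (drop (arity s) rs)"
      by auto
    then have "is_prefix G s (graft s (take (arity s) rs))"
      unfolding is_prefix_iff_graft
      by (intro bexI[of _ "take (arity s) rs"]) (auto dest: in_set_takeD)
    moreover have "list_all2 (is_prefix G) ss (graft_list ss (drop (arity s) rs))"
      using rs
      by (intro iffD1[OF Cons.IH] bexI[of _ "drop (arity s) rs"]) (auto dest: in_set_dropD)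
    ultimately show "list_all2 (is_prefix G) (s # ss) ts"
      by (simp add: rs)
  next
    assume "list_all2 (is_prefix G) (s # ss) ts"
    then obtain t ts' where ts: "ts = t # ts'" "is_prefix G s t" "list_all2 (is_prefix G) ss ts'"
      by (auto simp: list_all2_Cons1)
    then obtain rs rs' where "rs \<in> lists (gtrees G)" "length rs = arity s" "t = graft s rs"
      "rs' \<in> lists (gtrees G)" "length rs' = sum_list (map arity ss)" "ts' = graft_list ss rs'"
      unfolding is_prefix_iff_graft Cons.IH[symmetric] by blast
    then show "\<exists>rs\<in>lists (gtrees G).
      length rs = sum_list (map arity (s # ss)) \<and> ts = graft_list (s # ss) rs"
      by (intro bexI[of _ "rs @ rs'"]) (auto simp: ts)
  qed
qed auto

lemma is_prefix_Node_iff: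
  "is_prefix G (Node b ss) (Node a ts) \<longleftrightarrow> b = a \<and> list_all2 (is_prefix G) ss ts"
  unfolding graft_list_iff_prefixes[symmetric] by (auto simp: is_prefix_iff_graft)

lemma not_is_prefix_Node_Leaf [simp]: "\<not> is_prefix G (Node b ss) Leaf"
  by (simp add: is_prefix_iff_graft)

lemma is_factor_iff_graft_at:
  "is_factor G s t \<longleftrightarrow> (\<exists>r\<in>gtrees G. \<exists>i<arity r. \<exists>x. is_prefix G s x \<and> t = graft_at r i x)"
  unfolding is_factor_def is_prefix_iff_graft by blast

lemma is_factor_Leaf_iff [simp]: "is_factor G s Leaf \<longleftrightarrow> is_prefix G s Leaf"
proof
  assume "is_factor G s Leaf"
  then obtain r i x where "i < arity r" "is_prefix G s x" "Leaf = graft_at r i x"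
    unfolding is_factor_iff_graft_at by blast
  \<comment> \<open>Grafting onto a \<open>Node\<close> gives a \<open>Node\<close>, so the context
    \<open>r\<close> can only be \<open>Leaf\<close>.\<close>
  then show "is_prefix G s Leaf"
    by (cases r) (auto simp: graft_at_def)
next
  assume "is_prefix G s Leaf"
  then show "is_factor G s Leaf"
    unfolding is_factor_iff_graft_at
    by (intro bexI[of _ Leaf] exI[of _ 0] exI[of _ Leaf]) (auto intro: gtrees.Leaf)
qed

text \<open>The context \<open>r\<close> of an occurrence is either \<open>Leaf\<close>, with the
  occurrence at the root, or a node, whose marked leaf then lies under one of its children.\<close>

lemma is_factor_Node_iff:
  assumes "Node a ts \<in> gtrees G"
  shows "is_factor G s (Node a ts) \<longleftrightarrow>
    is_prefix G s (Node a ts) \<or> (\<exists>t\<in>set ts. is_factor G s t)"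
proof
  assume "is_factor G s (Node a ts)"
  then obtain r i x where r: "r \<in> gtrees G" "i < arity r" "is_prefix G s x"
    "Node a ts = graft_at r i x"
    unfolding is_factor_iff_graft_at by blast
  show "is_prefix G s (Node a ts) \<or> (\<exists>t\<in>set ts. is_factor G s t)"
  proof (cases r)
    case Leaf
    with r show ?thesis by simp
  next
    case (Node b us)
    with r obtain j i' where j: "j < length us" "i' < arity (us ! j)"
      "ts = us[j := graft_at (us ! j) i' x]"
      using graft_list_update_obtain[of i us x] by (auto simp: graft_at_def)
    have "us ! j \<in> gtrees G"
      using j(1) r(1) Node by auto
    then have "is_factor G s (graft_at (us ! j) i' x)"
      unfolding is_factor_iff_graft_at using j(2) r(3) by blast
    moreover have "graft_at (us ! j) i' x \<in> set ts"
      using j by (auto simp: set_update_memI)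
    ultimately show ?thesis by blast
  qed
next
  assume "is_prefix G s (Node a ts) \<or> (\<exists>t\<in>set ts. is_factor G s t)"
  then show "is_factor G s (Node a ts)"
  proof
    assume "is_prefix G s (Node a ts)"
    then show ?thesis
      unfolding is_factor_iff_graft_at
      by (intro bexI[of _ Leaf] exI[of _ 0] exI[of _ "Node a ts"]) (auto intro: gtrees.Leaf)
  next
    assume "\<exists>t\<in>set ts. is_factor G s t"
    then obtain j where j: "j < length ts" "is_factor G s (ts ! j)"
      by (auto simp: in_set_conv_nth)
    then obtain r i' x where r: "r \<in> gtrees G" "i' < arity r" "is_prefix G s x"
      "ts ! j = graft_at r i' x"
      unfolding is_factor_iff_graft_at by blast
    \<comment> \<open>The context in the parent: child \<open>j\<close> is replaced by the context
      \<open>r\<close> found inside it, and the other children are kept.\<close>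
    define us where "us = ts[j := r]"
    obtain i where "i < sum_list (map arity us)"
      "graft_list us ((replicate (sum_list (map arity us)) Leaf)[i := x]) =
        us[j := graft_at (us ! j) i' x]"
      using graft_list_update_exists[of j us i' x] j r by (auto simp: us_def)
    moreover have "us[j := graft_at (us ! j) i' x] = ts"
      using j r(4) by (simp add: us_def) (metis list_update_id)
    moreover have "Node a us \<in> gtrees G"
      using assms r(1) set_update_subset_insert[of ts j r] by (auto simp: us_def)
    ultimately show ?thesis
      unfolding is_factor_iff_graft_at using r(3)
      by (intro bexI[of _ "Node a us"] exI[of _ i] exI[of _ x]) (auto simp: graft_at_def)
  qed
qed

lemma factor_avoids_Node_iff:
  assumes "Node a ts \<in> gtrees G"
  shows "factor_avoids G (Node a ts) P \<longleftrightarrow>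
    prefix_avoids G (Node a ts) P \<and> (\<forall>t\<in>set ts. factor_avoids G t P)"
  unfolding factor_avoids_def prefix_avoids_def is_factor_Node_iff[OF assms] by blast

lemma avoiding_series_Leaf:
  assumes "Leaf \<notin> P" "Leaf \<notin> Q"
  shows "avoiding_series G P Q Leaf = 1"
proof -
  have "\<not> is_prefix G s Leaf" if "s \<in> P \<union> Q" for s
    using that assms by (cases s) auto
  then show ?thesis
    by (auto simp: avoiding_series_def factor_avoids_def prefix_avoids_def gtrees.Leaf)
qed

section \<open>Minimal consistent words\<close>

text \<open>
  A word is of the form \<open>V \<oplus> V'\<close> exactly when it dominates \<open>V\<close> for this order, so minimal
  consistent words are the minimal elements among the consistent words.
\<close>

abbreviation word_le :: "'a set list \<Rightarrow> 'a set list \<Rightarrow> bool" where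
  "word_le \<equiv> list_all2 (\<subseteq>)"

lemma consistent_mono:
  assumes "consistent G k X V" "word_le V W" "W \<in> tree_set_words G k"
  shows "consistent G k X W"
  unfolding consistent_def
proof (intro conjI assms(3) ballI)
  fix s assume "s \<in> X"
  then obtain i where "i < k" "children s ! i \<noteq> Leaf" "children s ! i \<in> V ! i"
    using assms(1) by (auto simp: consistent_def)
  moreover have "V ! i \<subseteq> W ! i"
    using assms(2,3) \<open>i < k\<close> by (simp add: list_all2_conv_all_nth tree_set_words_def)
  ultimately show "\<exists>i<k. children s ! i \<noteq> Leaf \<and> children s ! i \<in> W ! i"
    by blast
qed

lemma minimal_consistentI:
  assumes "consistent G k X W"
    and "\<And>V. consistent G k X V \<Longrightarrow> word_le V W \<Longrightarrow> V = W"
  shows "minimal_consistent G k X W"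
  unfolding minimal_consistent_def
proof (intro conjI allI impI assms(1), elim conjE)
  fix V V' assume V: "consistent G k X V" "V' \<in> tree_set_words G k" "W = V \<oplus> V'"
  have "length V = k" "length V' = k"
    using V(1,2) by (simp_all add: consistent_def tree_set_words_def)
  then have "word_le V W"
    by (simp add: V(3) word_add_def list_all2_conv_all_nth)
  with V(1) have "V = W"
    by (rule assms(2))
  then show "W = V" ..
qed

text \<open>Zorn's lemma is applied to the sets removed from \<open>H\<close>. Finiteness of each
  \<open>e s\<close> makes it work: a decreasing chain of hitting sets could otherwise have an
  intersection that misses some \<open>e s\<close>.\<close>

lemma minimal_hitting_set:
  assumes hit: "\<And>s. s \<in> X \<Longrightarrow> finite (e s) \<and> e s \<inter> H \<noteq> {}"
  obtains M where "M \<subseteq> H" "\<And>s. s \<in> X \<Longrightarrow> e s \<inter> M \<noteq> {}"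
    "\<And>M'. M' \<subseteq> M \<Longrightarrow> (\<And>s. s \<in> X \<Longrightarrow> e s \<inter> M' \<noteq> {}) \<Longrightarrow> M' = M"
proof -
  \<comment> \<open>The sets whose removal from \<open>H\<close> still leaves every
    \<open>e s\<close> hit; a maximal one has a minimal complement in \<open>H\<close>.\<close>
  define \<A> where "\<A> = {C. \<forall>s\<in>X. \<not> e s \<inter> H \<subseteq> C}"
  have "\<exists>C\<in>\<A>. \<forall>D\<in>\<A>. C \<subseteq> D \<longrightarrow> D = C"
  proof (rule subset_Zorn_nonempty)
    have "{} \<in> \<A>"
      using hit by (auto simp: \<A>_def)
    then show "\<A> \<noteq> {}" by blast
    fix \<C> assume "\<C> \<noteq> {}" and chain: "subset.chain \<A> \<C>"
    have "\<not> e s \<inter> H \<subseteq> \<Union>\<C>" if s: "s \<in> X" for s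
    proof
      assume "e s \<inter> H \<subseteq> \<Union>\<C>"
      \<comment> \<open>A finite set covered by a nonempty chain is contained in one of its
        members.\<close>
      then obtain C where "C \<in> \<C>" "e s \<inter> H \<subseteq> C"
        using finite_subset_Union_chain[of "e s \<inter> H" \<C> \<A>] \<open>\<C> \<noteq> {}\<close> chain hit[OF s]
        by (metis finite_Int)
      with chain s show False
        by (auto simp: \<A>_def subset.chain_def)
    qed
    then show "\<Union>\<C> \<in> \<A>" by (simp add: \<A>_def)
  qed
  then obtain C where C: "C \<in> \<A>" "\<And>D. D \<in> \<A> \<Longrightarrow> C \<subseteq> D \<Longrightarrow> D = C" by blast
  show ?thesis
  proof (rule that)
    show "H - C \<subseteq> H" by blast
    show "e s \<inter> (H - C) \<noteq> {}" if "s \<in> X" for s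
      using C(1) that by (auto simp: \<A>_def)
    show "M' = H - C" if "M' \<subseteq> H - C" "\<And>s. s \<in> X \<Longrightarrow> e s \<inter> M' \<noteq> {}" for M'
    proof -
      \<comment> \<open>A point of \<open>e s \<inter> M'\<close> lies in \<open>H\<close> but
        neither in \<open>C\<close> nor in \<open>H - M'\<close>. Maximality of \<open>C\<close>
        then gives \<open>H - M' \<subseteq> C\<close>, that is,
        \<open>H - C \<subseteq> M'\<close>.\<close>
      have "C \<union> (H - M') \<in> \<A>"
        using that by (fastforce simp: \<A>_def)
      then have "C \<union> (H - M') = C"
        by (intro C(2)) auto
      with that(1) show ?thesis by blast
    qed
  qed
qed

text \<open>
  Every tree imposes a condition on finitely many pairs (child index, subtree), so that
  consistent words correspond to hitting sets of a family of finite sets.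
\<close>

lemma minimal_word_below_consistent:
  assumes "consistent G k X W"
  obtains R where "R \<in> minimal_words G k X" "word_le R W"
proof -
  define e where "e s = {(i, children s ! i) | i. i < k \<and> children s ! i \<noteq> Leaf}" for s :: "'a gtree"
  define pairs where "pairs V = {(i, u). i < k \<and> u \<in> V ! i}" for V :: "'a gtree set list"
  have W: "length W = k" "\<And>i. i < k \<Longrightarrow> W ! i \<subseteq> gtrees G"
    using assms by (auto simp: consistent_def tree_set_words_def)
  have "e s \<inter> pairs V \<noteq> {} \<longleftrightarrow> (\<exists>i<k. children s ! i \<noteq> Leaf \<and> children s ! i \<in> V ! i)" for s V
    unfolding e_def pairs_def by blast
  then have cons: "consistent G k X V \<longleftrightarrow>
      V \<in> tree_set_words G k \<and> (\<forall>s\<in>X. e s \<inter> pairs V \<noteq> {})" for V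
    by (simp add: consistent_def)
  have "finite (e s)" for s
    by (simp add: e_def)
  then have hit: "finite (e s) \<and> e s \<inter> pairs W \<noteq> {}" if "s \<in> X" for s
    using assms that cons by blast
  obtain M where M: "M \<subseteq> pairs W" "\<And>s. s \<in> X \<Longrightarrow> e s \<inter> M \<noteq> {}"
    "\<And>M'. M' \<subseteq> M \<Longrightarrow> (\<And>s. s \<in> X \<Longrightarrow> e s \<inter> M' \<noteq> {}) \<Longrightarrow> M' = M"
    by (rule minimal_hitting_set[of X e "pairs W", OF hit]) blast+
  \<comment> \<open>The minimal hitting set is read back as a word; nothing is lost, because
    \<open>M \<subseteq> pairs W\<close> keeps all indices below \<open>k\<close>.\<close>
  define R where "R = map (\<lambda>i. {u. (i, u) \<in> M}) [0..<k]"
  have pR: "pairs R = M"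
    using M(1) by (auto simp: pairs_def R_def)
  have le: "word_le R W"
    using M(1) W(1) by (auto simp: R_def pairs_def list_all2_conv_all_nth)
  have R: "R \<in> tree_set_words G k"
    using M(1) W by (auto simp: R_def pairs_def tree_set_words_def)
  have "minimal_consistent G k X R"
  proof (rule minimal_consistentI)
    show "consistent G k X R"
      using cons R M(2) pR by blast
    fix V assume V: "consistent G k X V" "word_le V R"
    then have len: "length V = k" "length R = k"
      using R by (simp_all add: consistent_def tree_set_words_def)
    have sub: "pairs V \<subseteq> M"
      using V(2) len unfolding pR[symmetric] by (auto simp: pairs_def list_all2_conv_all_nth)
    have "pairs V = M"
      by (rule M(3)[OF sub]) (use V(1) cons in blast)
    \<comment> \<open>Words of length \<open>k\<close> are determined by their sets of pairs, so
      minimality of \<open>M\<close> passes to \<open>R\<close>.\<close>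
    then have "u \<in> V ! i \<longleftrightarrow> u \<in> R ! i" if "i < k" for i u
      using that unfolding pR[symmetric] by (auto simp: pairs_def set_eq_iff)
    then show "V = R"
      using len by (intro nth_equalityI) auto
  qed
  then show ?thesis
    using le by (intro that) (simp_all add: minimal_words_def)
qed

section \<open>The alternating sum and the coefficients at a node\<close>

text \<open>Adding or removing a fixed element \<open>x\<close> pairs the subsets of a nonempty set
  with opposite signs, so the sum over all of \<open>Pow A\<close> cancels.\<close>

lemma sum_nonempty_subsets_alternating:
  assumes "finite A"
  shows "(\<Sum>B | B \<subseteq> A \<and> B \<noteq> {}. (- 1) ^ (1 + card B)) = (if A = {} then 0 else (1 :: 'b::comm_ring_1))"
proof -
  have "(\<Sum>B\<in>Pow A. (- 1) ^ (1 + card B)) = (if A = {} then - 1 else (0 :: 'b))"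
    using assms
  proof (induction A)
    case (insert x A)
    have "(\<Sum>B\<in>Pow (insert x A). (- 1) ^ (1 + card B)) =
      (\<Sum>B\<in>Pow A. (- 1) ^ (1 + card B)) + (\<Sum>B\<in>insert x ` Pow A. (- 1) ^ (1 + card B) :: 'b)"
      unfolding Pow_insert using insert by (intro sum.union_disjoint) auto
    also have "(\<Sum>B\<in>insert x ` Pow A. (- 1) ^ (1 + card B) :: 'b) =
      (\<Sum>B\<in>Pow A. (- 1) ^ (1 + card (insert x B)))"
      using insert.hyps by (subst sum.reindex) (auto simp: inj_on_def o_def)
    also have "\<dots> = (\<Sum>B\<in>Pow A. - ((- 1) ^ (1 + card B)))"
      using insert.hyps by (intro sum.cong refl) (subst card_insert_disjoint; auto intro: finite_subset)
    finally show ?case by (simp add: sum_negf)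
  qed simp
  \<comment> \<open>The empty subset contributes \<open>- 1\<close>, so leaving it out raises both
    values by \<open>1\<close>.\<close>
  moreover have "Pow A = insert {} {B. B \<subseteq> A \<and> B \<noteq> {}}" by auto
  moreover have "finite {B. B \<subseteq> A \<and> B \<noteq> {}}" using assms by auto
  ultimately show ?thesis
    by (auto simp: algebra_simps split: if_splits)
qed

lemma arity_corolla [simp]: "arity (corolla k a) = k"
  by (simp add: corolla_def sum_list_replicate)

text \<open>Grafting onto a corolla turns the arguments into its children, so
  \<open>(corolla (length ts) a, ts)\<close> is the only decomposition on which
  \<open>single\<close> does not vanish; it is admissible exactly when all of \<open>ts\<close> are
  trees over \<open>G\<close>.\<close>

lemma series_comp_corolla:
  fixes gs :: "('a, 'k::field_char_0) tree_series list"
  assumes "a \<in> G (length ts)" "length gs = length ts"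
  shows "series_comp G (single (corolla (length ts) a)) gs (Node a ts) =
    (if set ts \<subseteq> gtrees G then \<Prod>i<length ts. (gs ! i) (ts ! i) else 0)"
proof -
  let ?c = "corolla (length ts) a"
  let ?D = "{(t, ss). t \<in> gtrees G \<and> arity t = length gs \<and> ss \<in> lists (gtrees G) \<and>
    length ss = length gs \<and> graft t ss = Node a ts}"
  let ?f = "\<lambda>(t, ss). single ?c t * (\<Prod>i<length gs. (gs ! i) (ss ! i)) :: 'k"
  have "finite ?D"
    by (rule finite_subset[OF _ finite_graft_decompositions[of "Node a ts"]]) auto
  then have "sum ?f ?D = sum ?f (?D \<inter> {(?c, ts)})"
    using assms by (intro sum.mono_neutral_right) (auto simp: single_def graft_corolla split: if_splits)
  also have "?D \<inter> {(?c, ts)} = (if set ts \<subseteq> gtrees G then {(?c, ts)} else {})"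
    using assms by (auto simp: graft_corolla lists_eq_set) (auto simp: corolla_def gtrees.Leaf)
  finally show ?thesis
    using assms(2) by (auto simp: series_comp_def single_def)
qed

text \<open>A tree with root \<open>a\<close> fails to be a prefix exactly when some child of it is
  not a prefix of the corresponding entry of \<open>ts\<close>. Such a child is never
  \<open>Leaf\<close>, which is a prefix of every tree over \<open>G\<close>; this matches the
  condition on leaves in \<open>consistent\<close>.\<close>

lemma avoiding_series_Node:
  assumes alph: "alphabet G" and P: "P \<subseteq> gtrees G - {Leaf}" and Q: "Q \<subseteq> gtrees G - {Leaf}"
    and a: "a \<in> G (length ts)" and ts: "set ts \<subseteq> gtrees G"
  defines "W \<equiv> map (\<lambda>t. {u \<in> gtrees G. \<not> is_prefix G u t}) ts"
  shows "avoiding_series G P Q (Node a ts) =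
    (if (\<forall>t\<in>set ts. factor_avoids G t P) \<and> consistent G (length ts) (rooted_at (P \<union> Q) a) W
     then 1 else 0)"
proof -
  let ?X = "rooted_at (P \<union> Q) a"
  have W: "W \<in> tree_set_words G (length ts)"
    by (auto simp: W_def tree_set_words_def)
  have "\<not> is_prefix G s (Node a ts) \<longleftrightarrow>
      (\<exists>i<length ts. children s ! i \<noteq> Leaf \<and> children s ! i \<in> W ! i)" if s: "s \<in> ?X" for s
  proof -
    obtain ss where ss: "s = Node a ss" "s \<in> gtrees G"
      using s P Q by (auto simp: rooted_at_def)
    \<comment> \<open>Disjointness of the alphabet gives \<open>a\<close> a single arity.\<close>
    then have "length ss = length ts"
      using alph a by (auto simp: alphabet_def disjoint_family_on_def)
    then show ?thesis
      using ss ts by (force simp: W_def is_prefix_Node_iff list_all2_conv_all_nth subset_iff)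
  qed
  then have "consistent G (length ts) ?X W \<longleftrightarrow> prefix_avoids G (Node a ts) ?X"
    using W by (simp add: consistent_def prefix_avoids_def)
  \<comment> \<open>A tree with another root label is never a prefix here. Occurrences of
    \<open>P\<close> at the root are prefixes too, which is why \<open>P\<close> and
    \<open>Q\<close> enter through their union.\<close>
  also have "\<dots> \<longleftrightarrow> prefix_avoids G (Node a ts) (P \<union> Q)"
  proof -
    have "s \<in> ?X" if "s \<in> P \<union> Q" "is_prefix G s (Node a ts)" for s
      using that P Q by (cases s) (auto simp: rooted_at_def is_prefix_Node_iff)
    then show ?thesis
      by (auto simp: prefix_avoids_def rooted_at_def)
  qed
  finally show ?thesis
    using a ts factor_avoids_Node_iff[of a ts G P]
    by (auto simp: avoiding_series_def prefix_avoids_def)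
qed

text \<open>The product of indicators is the indicator of a conjunction. Avoiding a union of entries
  means avoiding each of them, so the condition on the sum of the words splits into one condition
  per word.\<close>

lemma prod_avoiding_series_word_sum:
  fixes ts :: "'a gtree list"
  assumes ts: "set ts \<subseteq> gtrees G" and \<R>: "\<R> \<subseteq> tree_set_words G (length ts)"
  defines "W \<equiv> map (\<lambda>t. {u \<in> gtrees G. \<not> is_prefix G u t}) ts"
  shows "(\<Prod>i<length ts. (map (avoiding_series G P) (word_sum (length ts) \<R>) ! i) (ts ! i)) =
    (if (\<forall>t\<in>set ts. factor_avoids G t P) \<and> (\<forall>R\<in>\<R>. word_le R W)
     then 1 else (0 :: 'k::field_char_0))"
proof -
  let ?S = "\<lambda>i. \<Union>R\<in>\<R>. R ! i"
  have len: "length R = length ts" if "R \<in> \<R>" for R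
    using that \<R> by (auto simp: tree_set_words_def)
  have sub: "?S i \<subseteq> gtrees G" if "i < length ts" for i
    using that \<R> len by (fastforce simp: tree_set_words_def)
  have "(\<Prod>i<length ts. (map (avoiding_series G P) (word_sum (length ts) \<R>) ! i) (ts ! i)) =
    (\<Prod>i<length ts. if factor_avoids G (ts ! i) P \<and> prefix_avoids G (ts ! i) (?S i)
      then 1 else (0 :: 'k))"
    using ts by (intro prod.cong) (auto simp: word_sum_def avoiding_series_def subset_iff)
  also have "\<dots> = (if \<forall>i<length ts. factor_avoids G (ts ! i) P \<and> prefix_avoids G (ts ! i) (?S i)
      then 1 else 0)"
    by (auto intro!: prod.neutral)
  also have "(\<forall>i<length ts. factor_avoids G (ts ! i) P \<and> prefix_avoids G (ts ! i) (?S i)) \<longleftrightarrow>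
    (\<forall>t\<in>set ts. factor_avoids G t P) \<and> (\<forall>R\<in>\<R>. word_le R W)"
  proof -
    \<comment> \<open>Entries of \<open>W\<close> contain only trees over \<open>G\<close>, so
      \<open>sub\<close> is what allows the inclusion to be expressed by avoidance alone.\<close>
    have "prefix_avoids G (ts ! i) (?S i) \<longleftrightarrow> (\<forall>R\<in>\<R>. R ! i \<subseteq> W ! i)" if "i < length ts" for i
      using sub[OF that] that unfolding prefix_avoids_def W_def by auto
    moreover have "word_le R W \<longleftrightarrow> (\<forall>i<length ts. R ! i \<subseteq> W ! i)" if "R \<in> \<R>" for R
      using len[OF that] by (simp add: W_def list_all2_conv_all_nth)
    ultimately show ?thesis
      unfolding all_set_conv_all_nth by blast
  qed
  finally show ?thesis .
qed

section \<open>Comparison of coefficients, tree by tree\<close>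

theorem theorem2p2p4:
  fixes G :: "nat \<Rightarrow> 'a set" and P Q :: "'a gtree set"
  assumes "alphabet G"
    and "P \<subseteq> gtrees G - {Leaf}"
    and "Q \<subseteq> gtrees G - {Leaf}"
    and "\<And>k a. k \<ge> 1 \<Longrightarrow> a \<in> G k \<Longrightarrow> finite (minimal_words G k (rooted_at (P \<union> Q) a))"
  shows "(avoiding_series G P Q :: ('a, 'k::field_char_0) tree_series) =
    (\<lambda>t. single Leaf t +
      series_sum
        (\<lambda>(k, a). \<lambda>t.
          \<Sum>\<R> | \<R> \<subseteq> minimal_words G k (rooted_at (P \<union> Q) a) \<and> \<R> \<noteq> {}.
            (- 1) ^ (1 + card \<R>) *
            series_comp G (single (corolla k a)) (map (avoiding_series G P) (word_sum k \<R>)) t)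
        {(k, a). k \<ge> 1 \<and> a \<in> G k} t)"
proof
  fix t :: "'a gtree"
  let ?M = "\<lambda>k a. minimal_words G k (rooted_at (P \<union> Q) a)"
  let ?c = "\<lambda>k a \<R>. series_comp G (single (corolla k a))
    (map (avoiding_series G P) (word_sum k \<R>)) :: ('a, 'k) tree_series"
  define f where "f = (\<lambda>(k, a). \<lambda>t.
    \<Sum>\<R> | \<R> \<subseteq> ?M k a \<and> \<R> \<noteq> {}. (- 1) ^ (1 + card \<R>) * ?c k a \<R> t)"
  let ?L = "{(k, a). k \<ge> 1 \<and> a \<in> G k}"
  \<comment> \<open>The summand of a letter is supported on the trees with that letter at the root
    and the matching number of children. Hence at most one letter contributes to a given
    coefficient, and none at \<open>Leaf\<close>.\<close>
  have f_nonzero: "\<exists>ts. t = Node a ts \<and> length ts = k" if nz: "f (k, a) t \<noteq> 0" for k a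
  proof -
    obtain \<R> where "(- 1) ^ (1 + card \<R>) * ?c k a \<R> t \<noteq> 0"
      using nz unfolding f_def prod.case by (rule sum.not_neutral_contains_not_neutral)
    then have "?c k a \<R> t \<noteq> 0" by auto
    then show ?thesis by (rule series_comp_corolla_nonzeroD)
  qed
  have "avoiding_series G P Q t = single Leaf t + series_sum f ?L t"
  proof (cases t)
    case Leaf
    then have "series_sum f ?L t = 0"
      unfolding series_sum_def using f_nonzero by (intro sum.neutral) fastforce
    then show ?thesis
      using Leaf avoiding_series_Leaf[of P Q G] assms(2,3) by (auto simp: single_def)
  next
    case t: (Node a ts)
    let ?k = "length ts"
    have sum_f: "series_sum f ?L t = (if (?k, a) \<in> ?L then f (?k, a) t else 0)"
    proof -
      have "x = (?k, a)" if "f x t \<noteq> 0" for x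
        using f_nonzero[of "fst x" "snd x"] that t by (cases x) auto
      then have "series_sum f ?L t = (\<Sum>x\<in>{(?k, a)} \<inter> ?L. f x t)"
        unfolding series_sum_def by (intro sum.mono_neutral_left) auto
      then show ?thesis by simp
    qed
    show ?thesis
    proof (cases "a \<in> G ?k")
      case False
      then show ?thesis
        using sum_f t by (simp add: avoiding_series_def single_def)
    next
      case a: True
      \<comment> \<open>There are no letters of arity \<open>0\<close>, so the index
        \<open>(?k, a)\<close> does belong to \<open>?L\<close>.\<close>
      then have L: "?k \<ge> 1"
        using assms(1) by (cases ts) (auto simp: alphabet_def)
      have c: "?c ?k a \<R> t = (if set ts \<subseteq> gtrees G
          then \<Prod>i<?k. (map (avoiding_series G P) (word_sum ?k \<R>) ! i) (ts ! i) else 0)" for \<R>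
        unfolding t by (rule series_comp_corolla[of a G ts]) (auto simp: a word_sum_def)
      show ?thesis
      \<comment> \<open>If some child is not a tree over \<open>G\<close>, both coefficients are
        \<open>0\<close>.\<close>
      proof (cases "set ts \<subseteq> gtrees G")
        case False
        then show ?thesis
          using sum_f t c by (simp add: f_def avoiding_series_def single_def)
      next
        case ts: True
        define W where "W = map (\<lambda>t. {u \<in> gtrees G. \<not> is_prefix G u t}) ts"
        \<comment> \<open>The minimal words below the word of non-prefixes of the children; only
          their subsets survive in the alternating sum.\<close>
        define N where "N = {R \<in> ?M ?k a. word_le R W}"
        let ?A = "\<forall>u\<in>set ts. factor_avoids G u P"
        have fin: "finite (?M ?k a)"
          using L a by (rule assms(4))
        have words: "?M ?k a \<subseteq> tree_set_words G ?k"
          unfolding minimal_words_def minimal_consistent_def consistent_def by blast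
        have W: "W \<in> tree_set_words G ?k"
          by (auto simp: W_def tree_set_words_def)
        \<comment> \<open>Consistency passes to larger words, and each consistent word has a minimal
          one below it.\<close>
        have N: "N \<noteq> {} \<longleftrightarrow> consistent G ?k (rooted_at (P \<union> Q) a) W"
        proof
          assume "N \<noteq> {}"
          then obtain R where "consistent G ?k (rooted_at (P \<union> Q) a) R" "word_le R W"
            unfolding N_def minimal_words_def minimal_consistent_def by blast
          then show "consistent G ?k (rooted_at (P \<union> Q) a) W"
            using W by (rule consistent_mono)
        next
          assume "consistent G ?k (rooted_at (P \<union> Q) a) W"
          then obtain R where "R \<in> ?M ?k a" "word_le R W"
            by (rule minimal_word_below_consistent)
          then show "N \<noteq> {}"
            unfolding N_def by blast
        qed
        have "f (?k, a) t = (\<Sum>\<R> | \<R> \<subseteq> ?M ?k a \<and> \<R> \<noteq> {}.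
            (- 1) ^ (1 + card \<R>) * (if ?A \<and> (\<forall>R\<in>\<R>. word_le R W) then 1 else 0))"
          unfolding f_def prod.case
        proof (intro sum.cong refl arg_cong2[where f = "(*)"])
          fix \<R> assume "\<R> \<in> {\<R>. \<R> \<subseteq> ?M ?k a \<and> \<R> \<noteq> {}}"
          then have "\<R> \<subseteq> tree_set_words G ?k" using words by blast
          from prod_avoiding_series_word_sum[OF ts this, of P]
          show "?c ?k a \<R> t = (if ?A \<and> (\<forall>R\<in>\<R>. word_le R W) then 1 else 0)"
            using ts by (simp add: c W_def)
        qed
        \<comment> \<open>A set of minimal words with a member outside \<open>N\<close> has
          coefficient \<open>0\<close>; on the subsets of \<open>N\<close> only the condition
          \<open>?A\<close> on the children remains.\<close>
        also have "\<dots> = (\<Sum>\<R> | \<R> \<subseteq> N \<and> \<R> \<noteq> {}. (- 1) ^ (1 + card \<R>) * (if ?A then 1 else 0))"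
          using fin by (intro sum.mono_neutral_cong_right) (auto simp: N_def)
        \<comment> \<open>Inclusion-exclusion: the signs over the nonempty subsets of
          \<open>N\<close> add up to \<open>1\<close> if \<open>N\<close> is nonempty and to
          \<open>0\<close> otherwise.\<close>
        also have "\<dots> = (if ?A \<and> N \<noteq> {} then 1 else 0)"
          using sum_nonempty_subsets_alternating[of N, where 'b = 'k] fin
          by (auto simp: N_def sum_distrib_right[symmetric])
        also have "\<dots> = avoiding_series G P Q t"
          using N by (simp add: t W_def avoiding_series_Node[OF assms(1-3) a ts])
        finally show ?thesis
          using sum_f L a t by (simp add: single_def)
      qed
    qed
  qed
  then show "(avoiding_series G P Q t :: 'k) = single Leaf t + series_sum
        (\<lambda>(k, a). \<lambda>t.
          \<Sum>\<R> | \<R> \<subseteq> minimal_words G k (rooted_at (P \<union> Q) a) \<and> \<R> \<noteq> {}.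
            (- 1) ^ (1 + card \<R>) *
            series_comp G (single (corolla k a)) (map (avoiding_series G P) (word_sum k \<R>)) t)
        {(k, a). k \<ge> 1 \<and> a \<in> G k} t"
    unfolding f_def .
qed

end
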